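(* If $G$ is a cycle with an odd number $n\ge 3$ of vertices, then its Mycielskian $\mu(G)$ is Hamilton-connected.
   Context: For a graph $G$ with vertex set $X=\{x_1,\dots,x_n\}$, the Mycielskian $\mu(G)$ has vertex set $X\cup Y\cup\{z\}$ with $Y=\{y_1,\dots,y_n\}$ new vertices and $z$ a new vertex; its edges are the edges of $G$, the edges $zy_i$ for all $i$, and the edges $x_iy_j$ and $x_jy_i$ for every edge $x_ix_j$ of $G$. A graph is Hamilton-connected if for every pair of distinct vertices $u,v$ there is a Hamiltonian path from $u$ to $v$. *)

theory Defs
  imports "Graph_Theory.Graph_Theory"
begin

text \<open>
  Finite simple graphs are \<^const>\<open>pair_graph\<close>s: finite, loop-free, symmetric digraphs
  without parallel arcs, an edge between \<open>u\<close> and \<open>v\<close> being the pair of arcs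
  \<open>(u, v)\<close>, \<open>(v, u)\<close>.
\<close>

definition cycle_graph :: "'a pair_pre_digraph \<Rightarrow> bool" where
  "cycle_graph G \<longleftrightarrow>
     (\<exists>xs. 3 \<le> length xs \<and> distinct xs \<and> pverts G = set xs \<and>
        parcs G = (\<Union>i<length xs. {(xs ! i, xs ! (Suc i mod length xs)),
                                   (xs ! (Suc i mod length xs), xs ! i)}))"

datatype 'a myc_vertex = X 'a | Y 'a | Z

definition mycielskian :: "'a pair_pre_digraph \<Rightarrow> 'a myc_vertex pair_pre_digraph" where
  "mycielskian G =
     \<lparr> pverts = X ` pverts G \<union> Y ` pverts G \<union> {Z},
       parcs = {(X u, X v) | u v. (u, v) \<in> parcs G} \<union>
               {(X u, Y v) | u v. (u, v) \<in> parcs G} \<union>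
               {(Y u, X v) | u v. (u, v) \<in> parcs G} \<union>
               {(Y u, Z) | u. u \<in> pverts G} \<union>
               {(Z, Y u) | u. u \<in> pverts G} \<rparr>"

definition hamiltonian_path :: "('a, 'b) pre_digraph \<Rightarrow> 'a \<Rightarrow> 'a vwalk \<Rightarrow> 'a \<Rightarrow> bool" where
  "hamiltonian_path G u p v \<longleftrightarrow> vpath p G \<and> hd p = u \<and> last p = v \<and> set p = verts G"

definition hamilton_connected :: "('a, 'b) pre_digraph \<Rightarrow> bool" where
  "hamilton_connected G \<longleftrightarrow>
     (\<forall>u\<in>verts G. \<forall>v\<in>verts G. u \<noteq> v \<longrightarrow> (\<exists>p. hamiltonian_path G u p v))"

lemma pair_graph_cycle_graph:
  assumes "cycle_graph G"
  shows "pair_graph G"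
proof -
  from assms obtain xs where len: "3 \<le> length xs" and d: "distinct xs" and V: "pverts G = set xs"
    and E: "parcs G = (\<Union>i<length xs. {(xs ! i, xs ! (Suc i mod length xs)),
                                   (xs ! (Suc i mod length xs), xs ! i)})"
    unfolding cycle_graph_def by blast
  have mod: "Suc i mod length xs < length xs" "Suc i mod length xs \<noteq> i" if "i < length xs" for i
    using len that by (auto simp: mod_Suc)
  then have ne: "xs ! (Suc i mod length xs) \<noteq> xs ! i" if "i < length xs" for i
    using d that by (metis nth_eq_iff_index_eq)
  have sub: "fst e \<in> pverts G \<and> snd e \<in> pverts G \<and> fst e \<noteq> snd e" if "e \<in> parcs G" for e
    using that mod(1) ne[symmetric] ne unfolding E V by auto
  have "sym (parcs G)"
    unfolding E sym_def by auto
  with sub show ?thesis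
    by unfold_locales (auto simp: E V symmetric_def)
qed

lemma pair_graph_mycielskian:
  assumes "pair_graph G"
  shows "pair_graph (mycielskian G)"
proof -
  interpret G: pair_graph G by fact
  have s: "sym (parcs G)"
    using G.sym_arcs by (simp add: symmetric_def)
  have "parcs (mycielskian G) \<subseteq> pverts (mycielskian G) \<times> pverts (mycielskian G)"
    by (auto simp: mycielskian_def dest: G.in_arcsD1 G.in_arcsD2)
  moreover have "finite (pverts (mycielskian G))"
    by (simp add: mycielskian_def G.pair_finite_verts)
  moreover have "sym (parcs (mycielskian G))"
    using s by (auto simp: mycielskian_def sym_def)
  moreover have "fst e \<noteq> snd e" if "e \<in> parcs (mycielskian G)" for e
    using that by (auto simp: mycielskian_def dest: G.pair_no_loops)
  ultimately show ?thesis
    by unfold_locales (auto simp: symmetric_def intro: finite_subset)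
qed

end

theory Submission
  imports Defs
begin

text \<open>
  Forgetting the edges between \<open>X\<close>-vertices, the vertices other than \<open>Z\<close> form the bipartite double
  of an odd cycle, which is a single cycle \<open>w\<close> of length \<open>2 * n\<close>: the even positions carry the
  \<open>X\<close>-vertices, the odd positions the \<open>Y\<close>-vertices. In this picture \<open>Z\<close> is adjacent to all odd
  positions, and the \<open>X\<close>-edges are the almost antipodal chords joining an even \<open>i\<close> to
  \<open>i + n + 1\<close> and \<open>i + n - 1\<close>. Rotations by even amounts and reflections preserve this
  structure and reduce the problem to seven explicit families of Hamiltonian paths, each
  consisting of arcs of \<open>w\<close> joined by chords, then \<open>Z\<close>, then again such arcs (possibly none).
\<close>

section \<open>Walks as lists of successive arcs\<close>

lemma successively_upto:
  assumes "\<And>i. a \<le> i \<Longrightarrow> i < b \<Longrightarrow> P i (i + 1)"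
  shows "successively P [a..b]"
proof -
  have "P (a + int k) (a + (1 + int k))" if "Suc k < nat (b - a + 1)" for k
    using assms[of "a + int k"] that by (simp add: ac_simps)
  then show ?thesis
    by (simp add: successively_conv_nth)
qed

lemma hd_upto: "a \<le> b \<Longrightarrow> hd [a..b] = a"
  by (simp add: upto_rec1)

lemma last_upto: "a \<le> b \<Longrightarrow> last [a..b] = b"
  by (simp add: upto_rec2)

lemma vwalk_with_projI:
  assumes "p \<noteq> []" "set p \<subseteq> pverts H" "successively (\<lambda>u v. (u, v) \<in> parcs H) p"
  shows "vwalk p (with_proj H)"
proof -
  have "set (vwalk_arcs p) \<subseteq> parcs H"
    using assms(3) by (induction p rule: vwalk_arcs.induct) auto
  with assms show ?thesis
    by (auto simp: vwalk_def)
qed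

definition ham_joined :: "'a pair_pre_digraph \<Rightarrow> 'a \<Rightarrow> 'a \<Rightarrow> bool" where
  "ham_joined H u v \<longleftrightarrow> (\<exists>p. hamiltonian_path (with_proj H) u p v)"

lemma ham_joinedI:
  assumes "p \<noteq> []" "successively (\<lambda>u v. (u, v) \<in> parcs H) p" "distinct p" "set p = pverts H"
  shows "ham_joined H (hd p) (last p)"
  using assms by (auto simp: ham_joined_def hamiltonian_path_def intro!: vpathI vwalk_with_projI)

lemma successively_vwalk:
  assumes "vwalk p (with_proj H)"
  shows "successively (\<lambda>u v. (u, v) \<in> parcs H) p"
proof -
  from assms have "set (vwalk_arcs p) \<subseteq> parcs H"
    by (auto simp: vwalk_def)
  then show ?thesis
    by (induction p rule: vwalk_arcs.induct) auto
qed

lemma ham_joined_sym: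
  assumes "sym (parcs H)" "ham_joined H u v"
  shows "ham_joined H v u"
proof -
  from assms(2) obtain p where p: "vwalk p (with_proj H)" "distinct p" "hd p = u" "last p = v"
    "set p = pverts H"
    by (auto simp: ham_joined_def hamiltonian_path_def)
  then have "p \<noteq> []"
    by auto
  moreover have "successively (\<lambda>u v. (u, v) \<in> parcs H) (rev p)"
    using successively_vwalk[OF p(1)]
    by (auto elim!: successively_mono intro: symD[OF assms(1)])
  ultimately show ?thesis
    using p ham_joinedI[of "rev p" H] by (simp add: hd_rev last_rev)
qed

section \<open>The cycle \<open>w\<close> with its hub and chords, and its symmetries\<close>

text \<open>Positions are arbitrary integers and \<open>w\<close> has period \<open>2 * n\<close>,
  so rotations and reflections are mere substitutions in the index.\<close>

locale chorded_cycle =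
  fixes H :: "'v pair_pre_digraph" and w :: "int \<Rightarrow> 'v" and z :: 'v and n :: int
  assumes sym_parcs: "sym (parcs H)"
    and odd_n: "odd n" and n_ge: "n \<ge> 3"
    and pverts_eq: "pverts H = insert z (range w)"
    and w_ne_z: "w i \<noteq> z"
    and w_eq_iff: "w i = w j \<longleftrightarrow> 2 * n dvd i - j"
    and step: "(w i, w (i + 1)) \<in> parcs H"
    and chord: "even i \<Longrightarrow> (w i, w (i + n + 1)) \<in> parcs H"
    and hub: "odd i \<Longrightarrow> (z, w i) \<in> parcs H"
begin

lemma step_back: "(w (i + 1), w i) \<in> parcs H"
  using step sym_parcs by (blast dest: symD)

lemma hub_back: "odd i \<Longrightarrow> (w i, z) \<in> parcs H"
  using hub sym_parcs by (blast dest: symD)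

lemma w_cong: "2 * n dvd i - j \<Longrightarrow> w i = w j"
  by (simp add: w_eq_iff)

text \<open>Modulo \<open>2 * n\<close> the offset \<open>n - 1\<close> is the negative of
  \<open>n + 1\<close>, so \<open>chord\<close>, symmetry and periodicity yield all four signed
  offsets.\<close>

lemma arc_chord:
  assumes "even i" "\<bar>i - j\<bar> = n + 1 \<or> \<bar>i - j\<bar> = n - 1"
  shows "(w i, w j) \<in> parcs H"
proof -
  have ev: "even j"
    using assms odd_n by (auto simp: abs_if split: if_splits) presburger+
  from assms(2) consider "j = i + n + 1" | "i = j + n + 1" | "i = j + n - 1" | "j = i + n - 1"
    by linarith
  then show ?thesis
  proof cases
    case 1
    then show ?thesis using chord[OF assms(1)] by simp
  next
    case 2
    then show ?thesis using chord[OF ev] sym_parcs by (auto dest: symD)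
  next
    case 3
    have "w j = w (i + n + 1)"
      unfolding 3 by (intro w_cong) simp
    then show ?thesis using chord[OF assms(1)] by simp
  next
    case 4
    have "w i = w (j + n + 1)"
      unfolding 4 by (intro w_cong) simp
    then show ?thesis using chord[OF ev] sym_parcs by (auto dest: symD)
  qed
qed

text \<open>An even shift keeps the parity of positions, on which chords and hub arcs
  depend.\<close>

lemma chorded_cycle_rotate:
  assumes "even s"
  shows "chorded_cycle H (\<lambda>i. w (s + i)) z n"
proof
  show "pverts H = insert z (range (\<lambda>i. w (s + i)))"
    using surj_plus[of s] by (simp add: pverts_eq image_image[of w "(+) s" UNIV, symmetric])
qed (use assms sym_parcs odd_n n_ge w_ne_z step[of "s + _"] chord[of "s + _"] hub[of "s + _"]
      in \<open>auto simp: w_eq_iff algebra_simps\<close>)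

lemma chorded_cycle_reflect:
  assumes "even s"
  shows "chorded_cycle H (\<lambda>i. w (s - i)) z n"
proof
  have "surj (\<lambda>i. s - i)"
    by (rule surjI[of _ "\<lambda>i. s - i"]) simp
  then show "pverts H = insert z (range (\<lambda>i. w (s - i)))"
    by (simp add: pverts_eq image_image[of w "(-) s" UNIV, symmetric])
  show "w (s - i) = w (s - j) \<longleftrightarrow> 2 * n dvd i - j" for i j
    using dvd_minus_iff[of "2 * n" "i - j"] by (simp add: w_eq_iff)
  show "(w (s - i), w (s - (i + 1))) \<in> parcs H" for i
    using step_back[of "s - (i + 1)"] by simp
  \<comment> \<open>Reflection negates the offset of a chord, and \<open>arc_chord\<close> covers
    both signs.\<close>
  show "(w (s - i), w (s - (i + n + 1))) \<in> parcs H" if "even i" for i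
    using that assms n_ge by (intro arc_chord) auto
qed (use assms sym_parcs odd_n n_ge w_ne_z hub in auto)

section \<open>Hamiltonian paths as lists of integer positions\<close>

lemma range_w: "range w = w ` {c..<c + 2 * n}"
proof -
  have "w i \<in> w ` {c..<c + 2 * n}" for i
  proof
    let ?j = "c + (i - c) mod (2 * n)"
    show "w i = w ?j"
      by (intro w_cong) (simp add: diff_diff_eq[symmetric] minus_mod_eq_mult_div)
    show "?j \<in> {c..<c + 2 * n}"
      using n_ge by simp
  qed
  then show ?thesis
    by auto
qed

lemma inj_on_w: "inj_on w {c..<c + 2 * n}"
proof (rule inj_onI)
  fix i j assume ij: "i \<in> {c..<c + 2 * n}" "j \<in> {c..<c + 2 * n}" "w i = w j"
  then have "2 * n dvd i - j" by (simp add: w_eq_iff)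
  moreover from ij have "\<bar>i - j\<bar> < 2 * n" by auto
  ultimately show "i = j"
    using dvd_imp_le_int[of "i - j" "2 * n"] n_ge by auto
qed

text \<open>\<open>A\<close> and \<open>B\<close> hold the positions visited before and after the
  hub; an empty \<open>B\<close> ends the path in \<open>z\<close>. Any window of
  \<open>2 * n\<close> consecutive integers represents each cycle vertex once, and a free
  \<open>c\<close> allows convenient representatives.\<close>

lemma ham_joined_through_hub:
  fixes c :: int
  assumes "A \<noteq> []" "odd (last A)" "B \<noteq> [] \<Longrightarrow> odd (hd B)"
    and "successively (\<lambda>i j. (w i, w j) \<in> parcs H) A"
    and "successively (\<lambda>i j. (w i, w j) \<in> parcs H) B"
    and "distinct (A @ B)" "set (A @ B) = {c..<c + 2 * n}"
    and "w (hd A) = u" "last (z # map w B) = v"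
  shows "ham_joined H u v"
proof -
  let ?p = "map w A @ z # map w B"
  have inj: "inj_on w (set A \<union> set B)"
    using inj_on_w[of c] assms(7) by simp
  have dist: "distinct (map w (A @ B))"
    using assms(6) inj by (simp only: distinct_map set_append)
  have img: "w ` set A \<union> w ` set B = range w"
    using assms(7) range_w[of c] by (simp flip: image_Un)
  have "distinct ?p"
    using dist w_ne_z by auto
  moreover have "set ?p = pverts H"
    using img by (auto simp: pverts_eq)
  moreover have "successively (\<lambda>u v. (u, v) \<in> parcs H) ?p"
    using assms(1-5) hub hub_back
    by (cases B) (auto simp: successively_append_iff successively_Cons successively_map last_map hd_map)
  ultimately have "ham_joined H (hd ?p) (last ?p)"
    by (intro ham_joinedI) auto
  then show ?thesis
    using assms(1,8,9) by (simp add: hd_map)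
qed

lemmas path_simps = successively_append_iff successively_Cons successively_upto step step_back
  hd_upto last_upto hd_rev last_rev last_map hd_append last_append
  disjoint_iff set_eq_iff

section \<open>The explicit families of paths\<close>

lemma ham_joined_even_hub: "ham_joined H (w 0) z"
  by (rule ham_joined_through_hub[of "[0..2 * n - 1]" "[]" 0])
      (use n_ge in \<open>auto simp: path_simps\<close>)

text \<open>Going straight round would end at the even position \<open>2 * n - 2\<close>. Jumping
  there from \<open>n - 1\<close> and running backwards ends at the odd position \<open>n\<close>
  instead.\<close>

lemma ham_joined_odd_hub: "ham_joined H (w (- 1)) z"
proof -
  have arc: "(w (n - 1), w (2 * n - 2)) \<in> parcs H"
    using n_ge odd_n by (intro arc_chord) auto
  show ?thesis
    by (rule ham_joined_through_hub[of "[-1..n - 1] @ rev [n..2 * n - 2]" "[]" "-1"])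
      (use arc n_ge odd_n in \<open>auto simp: path_simps\<close>)
qed

lemma ham_joined_even_even:
  assumes "even d" "0 < d" "d < 2 * n"
  shows "ham_joined H (w 0) (w d)"
  by (rule ham_joined_through_hub[of "[0..d - 1]" "rev [d..2 * n - 1]" 0])
      (use assms in \<open>auto simp: path_simps\<close>)

text \<open>Leaving 0 by the chord to \<open>n + 1\<close> saves the positions from \<open>n\<close>
  down to 1 for the way after the hub.\<close>

lemma ham_joined_even_odd_adjacent: "ham_joined H (w 0) (w 1)"
proof -
  have arc: "(w 0, w (n + 1)) \<in> parcs H"
    using n_ge by (intro arc_chord) auto
  show ?thesis
    by (rule ham_joined_through_hub[of "0 # [n + 1..2 * n - 1]" "rev [1..n]" 0])
      (use arc n_ge odd_n in \<open>auto simp: path_simps\<close>)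
qed

text \<open>After the hub two arcs remain, joined by a chord of offset \<open>n - 1\<close>. The
  bound \<open>d \<le> 2 * n - 3\<close> keeps the first of them nonempty, and
  \<open>n \<le> d\<close> does so for the arc starting at 0.\<close>

lemma ham_joined_even_odd:
  assumes "odd d" "n \<le> d" "d \<le> 2 * n - 3"
  shows "ham_joined H (w 0) (w d)"
proof -
  have arc: "(w (d + 1), w (d - n + 2)) \<in> parcs H"
    using assms n_ge by (intro arc_chord) auto
  show ?thesis
    by (rule ham_joined_through_hub[of "[0..d - n + 1]" "rev [d + 1..2 * n - 1] @ [d - n + 2..d]" 0])
      (use arc assms n_ge odd_n in \<open>auto simp: path_simps\<close>)
qed

lemma ham_joined_odd_odd:
  assumes "odd d" "0 < d" "d \<le> n - 2"
  shows "ham_joined H (w (- 1)) (w d)"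
proof (cases "d = n - 2")
  \<comment> \<open>Here \<open>d + 2 - n = 0\<close>, so the arc from -1 downwards of the other
    case would be empty; the path enters the hub at once.\<close>
  case True
  have arc: "(w (2 * n - 2), w (n - 1)) \<in> parcs H" "(w (n - 1), w 0) \<in> parcs H"
    using n_ge odd_n by (auto intro!: arc_chord)
  show ?thesis
    by (rule ham_joined_through_hub[of "[- 1]" "[n..2 * n - 2] @ [n - 1] @ [0..n - 2]" "-1"])
      (use arc True n_ge odd_n in \<open>auto simp: path_simps\<close>)
next
  case False
  then have d: "d \<le> n - 3" using assms by simp
  \<comment> \<open>The window starts at \<open>d + 2 - n\<close>, hence ends at
    \<open>d + n + 1\<close>, an odd position by which the path can leave the hub.\<close>
  have arc: "(w (d + 2 - n), w (d + 1)) \<in> parcs H" "(w (n + 1), w 0) \<in> parcs H"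
    using assms n_ge odd_n by (auto intro!: arc_chord)
  show ?thesis
    by (rule ham_joined_through_hub[of "rev [d + 2 - n..- 1] @ [d + 1..n]" "rev [n + 1..d + n + 1] @ [0..d]" "d + 2 - n"])
      (use arc assms d n_ge odd_n in \<open>auto simp: path_simps\<close>)
qed

section \<open>Reduction of arbitrary endpoints by symmetry\<close>

lemma ham_joined_w_hub: "ham_joined H (w i) z"
proof (cases "even i")
  case True
  then interpret r: chorded_cycle H "\<lambda>k. w (i + k)" z n
    by (rule chorded_cycle_rotate)
  show ?thesis using r.ham_joined_even_hub by simp
next
  case False
  \<comment> \<open>Only even shifts are available, so an odd \<open>i\<close> is moved to position
    -1.\<close>
  then interpret r: chorded_cycle H "\<lambda>k. w ((i + 1) + k)" z n
    by (intro chorded_cycle_rotate) simp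
  show ?thesis using r.ham_joined_odd_hub by simp
qed

lemma representative:
  assumes "w i \<noteq> w j"
  obtains d where "0 < d" "d < 2 * n" "w j = w (i + d)" "even d \<longleftrightarrow> even (j - i)"
proof
  let ?d = "(j - i) mod (2 * n)"
  have "\<not> 2 * n dvd j - i"
    using assms w_eq_iff[of j i] by auto
  then show "0 < ?d" "?d < 2 * n"
    using n_ge pos_mod_bound[of "2 * n" "j - i"] pos_mod_sign[of "2 * n" "j - i"]
    by (auto simp: dvd_eq_mod_eq_0 order_less_le simp del: pos_mod_bound pos_mod_sign)
  show "w j = w (i + ?d)"
    by (intro w_cong) (simp add: diff_diff_eq[symmetric] minus_mod_eq_mult_div)
  show "even ?d \<longleftrightarrow> even (j - i)"
    by (simp add: dvd_mod_iff)
qed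

lemma ham_joined_from_even:
  assumes "even i" "w i \<noteq> w j"
  shows "ham_joined H (w i) (w j)"
proof -
  interpret rot: chorded_cycle H "\<lambda>k. w (i + k)" z n
    using assms(1) by (rule chorded_cycle_rotate)
  interpret refl: chorded_cycle H "\<lambda>k. w (i - k)" z n
    using assms(1) by (rule chorded_cycle_reflect)
  from assms(2) obtain d where d: "0 < d" "d < 2 * n" and j: "w j = w (i + d)"
    by (rule representative)
  have j': "w j = w (i - (2 * n - d))"
    unfolding j by (intro w_cong) simp
  \<comment> \<open>Reflection replaces \<open>d\<close> by \<open>2 * n - d\<close>: it takes
    \<open>2 * n - 1\<close> to 1 and the range from 3 to \<open>n\<close> to the range from
    \<open>n\<close> to \<open>2 * n - 3\<close>.\<close>
  have "even d \<or> d = 1 \<or> d = 2 * n - 1 \<or> n \<le> d \<and> d \<le> 2 * n - 3 \<or> 3 \<le> d \<and> d \<le> n"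
    using d by presburger
  then consider "even d" | "d = 1" | "d = 2 * n - 1" | "odd d" "n \<le> d" "d \<le> 2 * n - 3"
    | "odd d" "3 \<le> d" "d \<le> n"
    by blast
  then show ?thesis
  proof cases
    case 1
    then show ?thesis using rot.ham_joined_even_even d j by simp
  next
    case 2
    then show ?thesis using rot.ham_joined_even_odd_adjacent j by simp
  next
    case 3
    then show ?thesis using refl.ham_joined_even_odd_adjacent j' by simp
  next
    case 4
    then show ?thesis using rot.ham_joined_even_odd j by simp
  next
    case 5
    then show ?thesis using refl.ham_joined_even_odd[of "2 * n - d"] j' by simp
  qed
qed

lemma ham_joined_both_odd:
  assumes "odd i" "odd j" "w i \<noteq> w j"
  shows "ham_joined H (w i) (w j)"
proof -
  interpret rot: chorded_cycle H "\<lambda>k. w ((i + 1) + k)" z n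
    using assms(1) by (intro chorded_cycle_rotate) simp
  interpret refl: chorded_cycle H "\<lambda>k. w ((i - 1) - k)" z n
    using assms(1) by (intro chorded_cycle_reflect) simp
  from assms(3) obtain d where d: "0 < d" "d < 2 * n" and j: "w j = w (i + d)"
    and "even d \<longleftrightarrow> even (j - i)"
    by (rule representative)
  with assms have ev: "even d" by simp
  with d have d': "1 < d" "1 < 2 * n - d" by presburger+
  have j': "w j = w ((i - 1) - (2 * n - d - 1))"
    unfolding j by (intro w_cong) simp
  \<comment> \<open>With \<open>w i\<close> at position -1, the other endpoint sits at
    \<open>d - 1\<close> after rotation and at \<open>2 * n - d - 1\<close> after reflection; one of
    these is at most \<open>n - 2\<close>.\<close>
  have "d \<le> n - 1 \<or> n + 1 \<le> d"
    using ev odd_n by presburger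
  then show ?thesis
  proof
    assume "d \<le> n - 1"
    then show ?thesis
      using rot.ham_joined_odd_odd[of "d - 1"] d' ev j by simp
  next
    assume "n + 1 \<le> d"
    then show ?thesis
      using refl.ham_joined_odd_odd[of "2 * n - d - 1"] d' ev j' by simp
  qed
qed

lemma ham_joined_w_w:
  assumes "w i \<noteq> w j"
  shows "ham_joined H (w i) (w j)"
  using assms ham_joined_from_even[of i j] ham_joined_from_even[of j i] ham_joined_both_odd[of i j]
    ham_joined_sym[OF sym_parcs]
  by metis

theorem hamilton_connected: "hamilton_connected (with_proj H)"
  using ham_joined_w_w ham_joined_w_hub ham_joined_sym[OF sym_parcs ham_joined_w_hub]
  by (auto simp: hamilton_connected_def pverts_eq simp flip: ham_joined_def)

end

section \<open>The Mycielskian of an odd cycle as a chorded cycle\<close>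

lemma chorded_cycle_mycielskian:
  fixes xs :: "'a list"
  assumes "pair_graph G" "odd (length xs)" "3 \<le> length xs" "distinct xs" "pverts G = set xs"
    and E: "parcs G = (\<Union>i<length xs. {(xs ! i, xs ! (Suc i mod length xs)),
                                   (xs ! (Suc i mod length xs), xs ! i)})"
  defines "x \<equiv> \<lambda>i. xs ! nat (i mod int (length xs))"
  shows "chorded_cycle (mycielskian G) (\<lambda>i. if even i then X (x i) else Y (x i)) Z (int (length xs))"
    (is "chorded_cycle ?H ?w Z ?n")
proof
  have n: "?n > 0" "odd ?n" using assms(2,3) by auto
  show "odd ?n" "?n \<ge> 3" using assms(2,3) by auto
  interpret H: pair_graph ?H
    using assms(1) by (rule pair_graph_mycielskian)
  show symH: "sym (parcs ?H)"
    using H.sym_arcs by (simp add: symmetric_def)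
  interpret G: pair_graph G by fact
  have symG: "sym (parcs G)"
    using G.sym_arcs by (simp add: symmetric_def)
  have x_eq_iff: "x i = x j \<longleftrightarrow> ?n dvd i - j" for i j
  proof -
    have "x i = x j \<longleftrightarrow> nat (i mod ?n) = nat (j mod ?n)"
      unfolding x_def using assms(4) n by (intro nth_eq_iff_index_eq) (auto simp: nat_less_iff)
    also have "\<dots> \<longleftrightarrow> i mod ?n = j mod ?n"
      using n by (simp add: eq_nat_nat_iff)
    finally show ?thesis by (simp add: mod_eq_dvd_iff)
  qed
  have x_in: "x i \<in> pverts G" for i
    unfolding x_def assms(5) using n by (intro nth_mem) (auto simp: nat_less_iff)
  have x_step: "(x i, x (i + 1)) \<in> parcs G" for i
  proof -
    let ?k = "nat (i mod ?n)"
    have k: "int ?k = i mod ?n" "?k < length xs"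
      using n by (auto simp: nat_less_iff)
    have "nat ((i + 1) mod ?n) = Suc ?k mod length xs"
    proof -
      have "int (Suc ?k mod length xs) = (i + 1) mod ?n"
        using k(1) by (simp add: zmod_int mod_add_left_eq add.commute[of 1])
      then show ?thesis by (metis nat_int)
    qed
    with k(2) show ?thesis
      unfolding E x_def by auto
  qed
  have x_back: "(x (i + 1), x i) \<in> parcs G" for i
    using x_step symG by (blast dest: symD)
  have x_shift: "x (i + ?n) = x i" for i
    by (simp add: x_def)
  show "(?w i, ?w (i + 1)) \<in> parcs ?H" for i
    using x_step[of i] by (auto simp: mycielskian_def)
  \<comment> \<open>As \<open>i + n + 1\<close> is again even and \<open>x\<close> has period
    \<open>n\<close>, the chord is the edge from \<open>X (x i)\<close> to
    \<open>X (x (i + 1))\<close>.\<close>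
  show "(?w i, ?w (i + ?n + 1)) \<in> parcs ?H" if "even i" for i
    using x_step[of i] that n x_shift[of "i + 1"] by (auto simp: mycielskian_def algebra_simps)
  show "(Z, ?w i) \<in> parcs ?H" if "odd i" for i
    using that x_in by (auto simp: mycielskian_def)
  show "?w i \<noteq> Z" for i by auto
  show "?w i = ?w j \<longleftrightarrow> 2 * ?n dvd i - j" for i j
  proof -
    \<comment> \<open>Since \<open>n\<close> is odd, a position modulo \<open>2 * n\<close> amounts
      to its parity, which selects \<open>X\<close> or \<open>Y\<close>, and its residue modulo
      \<open>n\<close>, which selects the vertex of \<open>G\<close>.\<close>
    have "2 * ?n dvd i - j \<longleftrightarrow> 2 dvd i - j \<and> ?n dvd i - j"
      using n(2) by (intro iffI conjI divides_mult) (auto dest: dvd_mult_left dvd_mult_right)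
    then show ?thesis
      by (auto simp: x_eq_iff)
  qed
  show "pverts ?H = insert Z (range ?w)"
  proof -
    \<comment> \<open>The positions \<open>k\<close> and \<open>k + n\<close> carry the same vertex
      of \<open>G\<close> and have opposite parities.\<close>
    have surj: "\<exists>i. even i = b \<and> x i = u" if "u \<in> pverts G" for u b
    proof -
      from that obtain k where k: "k < length xs" "xs ! k = u"
        by (auto simp: assms(5) in_set_conv_nth)
      then have "x (int k) = u" "x (int k + ?n) = u"
        by (simp_all add: x_def)
      moreover have "even (int k + ?n) \<longleftrightarrow> odd (int k)"
        using n(2) by simp
      ultimately show ?thesis
        by metis
    qed
    have "X u \<in> range ?w" "Y u \<in> range ?w" if "u \<in> pverts G" for u
      using surj[OF that, of True] surj[OF that, of False] by (auto simp: image_iff)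
    with x_in show ?thesis
      by (auto simp: mycielskian_def)
  qed
qed

theorem theorem13:
  fixes G :: "'a pair_pre_digraph" and n :: nat
  assumes "cycle_graph G"
    and "card (pverts G) = n"
    and "odd n" and "n \<ge> 3"
  shows "hamilton_connected (with_proj (mycielskian G))"
proof -
  from assms(1) obtain xs where xs: "3 \<le> length xs" "distinct xs" "pverts G = set xs"
    "parcs G = (\<Union>i<length xs. {(xs ! i, xs ! (Suc i mod length xs)),
                                   (xs ! (Suc i mod length xs), xs ! i)})"
    unfolding cycle_graph_def by blast
  moreover from this assms have "odd (length xs)"
    by (simp add: distinct_card)
  ultimately show ?thesis
    using chorded_cycle_mycielskian[OF pair_graph_cycle_graph[OF assms(1)]]
    by (blast intro: chorded_cycle.hamilton_connected)
qed

end
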